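(* Let $m\ge 0$ be an integer, let $\psi,\varphi,\phi$ be entire functions, and let $\mathbb{S}_{\max}$ be the maximal multi-valued weighted composition operator on $\mathcal{F}^2$ induced by the equation $\psi\cdot f\circ\varphi=\phi\cdot g^{(m)}$. Then $\mathbb{S}_{\max}$ is closed on $\mathcal{F}^2$, i.e. its graph $G(\mathbb{S}_{\max})$ is closed in $\mathcal{F}^2\times\mathcal{F}^2$.
   Context: Fock space $\mathcal{F}^2$ is the Hilbert space of entire functions $f$ with $\int_{\mathbb{C}}|f(z)|^2e^{-|z|^2}dV(z)<\infty$, with inner product $\langle f,g\rangle=\frac1\pi\int_{\mathbb{C}}f(z)\overline{g(z)}e^{-|z|^2}dV(z)$, where $dV$ is area measure. $\mathbb{S}_{\max}$ is the multi-valued linear operator on $\mathcal{F}^2$ with graph $G(\mathbb{S}_{\max})=\{(f,g)\in\mathcal{F}^2\times\mathcal{F}^2:\psi(z)f(\varphi(z))=\phi(z)g^{(m)}(z)\ \forall z\in\mathbb{C}\}$. *)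

theory Defs
  imports "HOL-Complex_Analysis.Complex_Analysis"
begin

definition fock_space :: "(complex \<Rightarrow> complex) set" where
  "fock_space = {f. f holomorphic_on UNIV \<and>
     integrable lborel (\<lambda>z. (cmod (f z))\<^sup>2 * exp (- (cmod z)\<^sup>2))}"

definition fock_inner :: "(complex \<Rightarrow> complex) \<Rightarrow> (complex \<Rightarrow> complex) \<Rightarrow> complex" where
  "fock_inner f g =
     1 / of_real pi * (LINT z|lborel. f z * cnj (g z) * of_real (exp (- (cmod z)\<^sup>2)))"

definition fock_norm :: "(complex \<Rightarrow> complex) \<Rightarrow> real" where
  "fock_norm f = sqrt (Re (fock_inner f f))"

definition fock_dist :: "(complex \<Rightarrow> complex) \<Rightarrow> (complex \<Rightarrow> complex) \<Rightarrow> real" where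
  "fock_dist f g = fock_norm (\<lambda>z. f z - g z)"

text \<open>The norm topology. The metric space axioms are established in \<open>Metric_space_fock\<close> below.\<close>

definition fock_topology :: "(complex \<Rightarrow> complex) topology" where
  "fock_topology = Metric_space.mtopology fock_space fock_dist"

text \<open>A multi-valued operator is given by its graph: \<open>g\<close> is one of the values at \<open>f\<close> iff the
  pair \<open>(f, g)\<close> belongs to the graph. The arguments are the order \<open>m\<close> of the derivative, the
  weight \<open>\<psi>\<close> and the symbol \<open>\<phi>\<close> on the left, and the weight \<open>\<Phi>\<close> of the derivative on
  the right of the equation.\<close>

definition Smax_graph ::
    "nat \<Rightarrow> (complex \<Rightarrow> complex) \<Rightarrow> (complex \<Rightarrow> complex) \<Rightarrow> (complex \<Rightarrow> complex) \<Rightarrow>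
     ((complex \<Rightarrow> complex) \<times> (complex \<Rightarrow> complex)) set" where
  "Smax_graph m \<psi> \<phi> \<Phi> =
     {(f, g) \<in> fock_space \<times> fock_space. \<forall>z. \<psi> z * f (\<phi> z) = \<Phi> z * (deriv ^^ m) g z}"


lemma fock_space_integrable:
  assumes "f \<in> fock_space"
  shows "integrable lborel (\<lambda>z. (cmod (f z))\<^sup>2 * exp (- (cmod z)\<^sup>2))"
  using assms by (simp add: fock_space_def)

lemma fock_space_holomorphic: "f \<in> fock_space \<Longrightarrow> f holomorphic_on UNIV"
  by (simp add: fock_space_def)

lemma fock_norm_eq:
  "fock_norm f = sqrt ((LINT z|lborel. (cmod (f z))\<^sup>2 * exp (- (cmod z)\<^sup>2)) / pi)"
proof -
  have "fock_inner f f = of_real ((LINT z|lborel. (cmod (f z))\<^sup>2 * exp (- (cmod z)\<^sup>2)) / pi)"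
    unfolding fock_inner_def complex_norm_square[symmetric] of_real_mult[symmetric]
      integral_complex_of_real by simp
  then show ?thesis
    by (simp add: fock_norm_def)
qed

lemma fock_norm_power2:
  "(fock_norm f)\<^sup>2 = (LINT z|lborel. (cmod (f z))\<^sup>2 * exp (- (cmod z)\<^sup>2)) / pi"
  unfolding fock_norm_eq by (rule real_sqrt_pow2) (auto intro!: divide_nonneg_pos)

lemma fock_norm_nonneg [simp]: "0 \<le> fock_norm f"
  unfolding fock_norm_eq by (auto intro!: divide_nonneg_pos)

lemma norm_add_power2_le:
  fixes a b :: "'a::real_normed_vector"
  assumes "t > 0"
  shows "(norm (a + b))\<^sup>2 \<le> (1 + t) * (norm a)\<^sup>2 + (1 + 1 / t) * (norm b)\<^sup>2"
proof -
  have "(norm (a + b))\<^sup>2 \<le> (norm a + norm b)\<^sup>2"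
    by (intro power_mono norm_triangle_ineq) auto
  also have "\<dots> = (norm a)\<^sup>2 + (norm b)\<^sup>2 + 2 * norm a * norm b"
    by (simp add: power2_sum)
  also have "2 * norm a * norm b \<le> t * (norm a)\<^sup>2 + (norm b)\<^sup>2 / t"
  proof -
    have "0 \<le> (t * norm a - norm b)\<^sup>2 / t"
      using assms by simp
    also have "\<dots> = t * (norm a)\<^sup>2 + (norm b)\<^sup>2 / t - 2 * norm a * norm b"
      using assms by (simp add: field_simps power2_eq_square)
    finally show ?thesis by simp
  qed
  finally show ?thesis by (simp add: algebra_simps)
qed

lemma fock_space_add:
  assumes f: "f \<in> fock_space" and g: "g \<in> fock_space"
  shows "(\<lambda>z. f z + g z) \<in> fock_space"
proof -
  have h: "(\<lambda>z. f z + g z) holomorphic_on UNIV"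
    using f g by (intro holomorphic_intros) (auto simp: fock_space_def)
  have c: "continuous_on UNIV (\<lambda>z. f z + g z)"
    by (rule holomorphic_on_imp_continuous_on[OF h])
  have "integrable lborel (\<lambda>z. (cmod (f z + g z))\<^sup>2 * exp (- (cmod z)\<^sup>2))"
  proof (rule Bochner_Integration.integrable_bound)
    show "integrable lborel (\<lambda>z. 2 * ((cmod (f z))\<^sup>2 * exp (- (cmod z)\<^sup>2))
        + 2 * ((cmod (g z))\<^sup>2 * exp (- (cmod z)\<^sup>2)))"
      using fock_space_integrable[OF f] fock_space_integrable[OF g] by simp
    have "continuous_on UNIV (\<lambda>z. (cmod (f z + g z))\<^sup>2 * exp (- (cmod z)\<^sup>2))"
      by (intro continuous_intros c)
    then show "(\<lambda>z. (cmod (f z + g z))\<^sup>2 * exp (- (cmod z)\<^sup>2)) \<in> borel_measurable lborel"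
      using borel_measurable_continuous_onI by auto
    have "(cmod (f z + g z))\<^sup>2 * exp (- (cmod z)\<^sup>2) \<le> 2 * ((cmod (f z))\<^sup>2 * exp (- (cmod z)\<^sup>2))
        + 2 * ((cmod (g z))\<^sup>2 * exp (- (cmod z)\<^sup>2))" for z
      using mult_right_mono[OF norm_add_power2_le[of 1 "f z" "g z"], of "exp (- (cmod z)\<^sup>2)"]
      by (simp add: algebra_simps)
    then show "AE z in lborel. norm ((cmod (f z + g z))\<^sup>2 * exp (- (cmod z)\<^sup>2)) \<le>
        norm (2 * ((cmod (f z))\<^sup>2 * exp (- (cmod z)\<^sup>2))
        + 2 * ((cmod (g z))\<^sup>2 * exp (- (cmod z)\<^sup>2)))"
      by (simp add: add_nonneg_nonneg)
  qed
  with h show ?thesis by (simp add: fock_space_def)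
qed

lemma fock_space_cmult:
  assumes "f \<in> fock_space"
  shows "(\<lambda>z. c * f z) \<in> fock_space"
  using assms integrable_mult_right[of "(cmod c)\<^sup>2", OF fock_space_integrable[OF assms]]
  by (auto simp: fock_space_def norm_mult power_mult_distrib mult.assoc intro!: holomorphic_intros)

lemma fock_space_diff:
  assumes "f \<in> fock_space" "g \<in> fock_space"
  shows "(\<lambda>z. f z - g z) \<in> fock_space"
  using fock_space_add[OF assms(1) fock_space_cmult[OF assms(2), of "- 1"]] by simp

lemma fock_norm_eq_0_iff:
  assumes f: "f \<in> fock_space"
  shows "fock_norm f = 0 \<longleftrightarrow> f = (\<lambda>z. 0)"
proof
  assume "fock_norm f = 0"
  then have "(LINT z|lborel. (cmod (f z))\<^sup>2 * exp (- (cmod z)\<^sup>2)) = 0"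
    by (simp add: fock_norm_eq)
  then have "AE z in lborel. (cmod (f z))\<^sup>2 * exp (- (cmod z)\<^sup>2) = 0"
    by (subst (asm) integral_nonneg_eq_0_iff_AE[OF fock_space_integrable[OF f]]) auto
  then have "AE z in lborel. f z = 0"
    by simp
  then have ae: "AE z\<in>UNIV in lebesgue. z \<in> {z. f z = 0}"
    by (auto intro: AE_completion)
  have "closed {z. f z = 0}"
    using holomorphic_on_imp_continuous_on[OF fock_space_holomorphic[OF f]]
    by (intro closed_Collect_eq) auto
  from mem_closed_if_AE_lebesgue_open[OF _ this ae] show "f = (\<lambda>z. 0)"
    by auto
qed (simp add: fock_norm_eq)

lemma fock_norm_triangle:
  assumes f: "f \<in> fock_space" and g: "g \<in> fock_space"
  shows "fock_norm (\<lambda>z. f z + g z) \<le> fock_norm f + fock_norm g"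
proof (cases "fock_norm f = 0 \<or> fock_norm g = 0")
  case True
  then show ?thesis
    using fock_norm_eq_0_iff[OF f] fock_norm_eq_0_iff[OF g] by auto
next
  case False
  then have pos: "fock_norm f > 0" "fock_norm g > 0"
    by (simp_all add: order_le_neq_trans[OF fock_norm_nonneg not_sym])
  define t where "t = fock_norm g / fock_norm f"
  have t: "t > 0"
    using pos by (simp add: t_def)
  let ?I = "\<lambda>h. LINT z|lborel. (cmod (h z))\<^sup>2 * exp (- (cmod z)\<^sup>2)"
  have "?I (\<lambda>z. f z + g z) \<le> (LINT z|lborel. (1 + t) * ((cmod (f z))\<^sup>2 * exp (- (cmod z)\<^sup>2))
        + (1 + 1 / t) * ((cmod (g z))\<^sup>2 * exp (- (cmod z)\<^sup>2)))"
  proof (rule integral_mono)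
    show "integrable lborel (\<lambda>z. (1 + t) * ((cmod (f z))\<^sup>2 * exp (- (cmod z)\<^sup>2))
        + (1 + 1 / t) * ((cmod (g z))\<^sup>2 * exp (- (cmod z)\<^sup>2)))"
      using fock_space_integrable[OF f] fock_space_integrable[OF g] by simp
    show "(cmod (f z + g z))\<^sup>2 * exp (- (cmod z)\<^sup>2)
        \<le> (1 + t) * ((cmod (f z))\<^sup>2 * exp (- (cmod z)\<^sup>2))
        + (1 + 1 / t) * ((cmod (g z))\<^sup>2 * exp (- (cmod z)\<^sup>2))" for z
      using mult_right_mono[OF norm_add_power2_le[OF t, of "f z" "g z"], of "exp (- (cmod z)\<^sup>2)"]
      by (simp add: distrib_right mult.assoc)
  qed (rule fock_space_integrable[OF fock_space_add[OF f g]])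
  also have "\<dots> = (1 + t) * ?I f + (1 + 1 / t) * ?I g"
    using fock_space_integrable[OF f] fock_space_integrable[OF g] by simp
  finally have "(fock_norm (\<lambda>z. f z + g z))\<^sup>2 \<le>
      (1 + t) * (fock_norm f)\<^sup>2 + (1 + 1 / t) * (fock_norm g)\<^sup>2"
    unfolding fock_norm_power2 times_divide_eq_right add_divide_distrib[symmetric]
    by (rule divide_right_mono) simp
  also have "\<dots> = (fock_norm f + fock_norm g)\<^sup>2"
    using pos by (simp add: t_def power2_eq_square field_simps)
  finally show ?thesis
    by (rule power2_le_imp_le) (intro add_nonneg_nonneg fock_norm_nonneg)
qed

lemma Metric_space_fock: "Metric_space fock_space fock_dist"
proof
  fix f g h :: "complex \<Rightarrow> complex"
  show "0 \<le> fock_dist f g"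
    by (simp add: fock_dist_def)
  show "fock_dist f g = fock_dist g f"
    by (simp add: fock_dist_def fock_norm_eq norm_minus_commute)
  assume f: "f \<in> fock_space" and g: "g \<in> fock_space"
  show "fock_dist f g = 0 \<longleftrightarrow> f = g"
    unfolding fock_dist_def fock_norm_eq_0_iff[OF fock_space_diff[OF f g]]
    by (auto simp: fun_eq_iff)
  assume h: "h \<in> fock_space"
  show "fock_dist f h \<le> fock_dist f g + fock_dist g h"
    using fock_norm_triangle[OF fock_space_diff[OF f g] fock_space_diff[OF g h]]
    by (simp add: fock_dist_def)
qed

end

theory Submission
  imports Defs
begin

text \<open>
  The graph is cut out of \<open>fock_space \<times> fock_space\<close> by one equation for each point \<open>z\<close>, and each
  equation only involves the values \<open>f (\<phi> z)\<close> and \<open>(deriv ^^ m) g z\<close>. So it is an intersection of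
  closed sets as soon as point evaluations, of functions and of their derivatives, are continuous
  for the Fock norm (\<open>continuous_map_fock_higher_deriv\<close>).

  This continuity is what holomorphy provides. By Cauchy's integral formula the square of an
  entire function \<open>f\<close> has the mean value property on circles. Averaging it over all points of a unit
  disc bounds \<open>\<pi> \<bar>f a\<bar>\<^sup>2\<close> by the integral of \<open>\<bar>f\<bar>\<^sup>2\<close> over that disc
  (\<open>entire_sub_mean_value_disc\<close>). On a bounded set the Gaussian weight is bounded below, so the
  latter is at most a constant times the square of the Fock norm (\<open>fock_eval_bound\<close>). Cauchy's
  inequality then carries the locally uniform bound over to the derivatives
  (\<open>fock_higher_deriv_bound\<close>).

  The averaging does not use polar coordinates: Tonelli's theorem exchanges the integral over the
  disc with the one over the angle, and for each fixed angle the integral over the disc does not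
  change because rotations preserve area (\<open>distr_lborel_cis_mult\<close>).
\<close>

unbundle no fps_syntax

section \<open>Rotation invariance of area measure\<close>

lemma distr_lborel_orthogonal_transformation:
  fixes T :: "real^'n::{finite,wellorder} \<Rightarrow> real^'n::_"
  assumes T: "orthogonal_transformation T"
  shows "distr lborel borel T = lborel"
proof (rule sym, rule lborel_eqI)
  fix l u :: "real^'n::{finite,wellorder}"
  assume lu: "\<And>b. b \<in> Basis \<Longrightarrow> l \<bullet> b \<le> u \<bullet> b"
  have T': "orthogonal_transformation (inv T)"
    using T by (rule orthogonal_transformation_inv)
  have [measurable]: "T \<in> borel_measurable borel"
    using T by (intro borel_measurable_continuous_onI linear_continuous_on
        linear_linear[THEN iffD2] orthogonal_transformation_linear)
  have pre: "T -` box l u = inv T ` box l u"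
    using orthogonal_transformation_bij[OF T] by (simp add: bij_vimage_eq_inv_image)
  have lm: "inv T ` box l u \<in> lmeasurable"
    by (intro measurable_orthogonal_image T') simp
  have "emeasure (distr lborel borel T) (box l u) = emeasure lborel (T -` box l u)"
    by (subst emeasure_distr) auto
  also have "\<dots> = emeasure lebesgue (T -` box l u)"
    using measurable_sets[of T borel borel "box l u"] by (simp add: emeasure_completion)
  also have "\<dots> = measure lebesgue (box l u)"
    unfolding pre using lm
    by (simp add: emeasure_eq_measure2 measure_orthogonal_image[OF T'])
  also have "\<dots> = (\<Prod>b\<in>Basis. (u - l) \<bullet> b)"
    using lu by (simp add: measure_lborel_box_eq inner_diff_left)
  finally show "emeasure (distr lborel borel T) (box l u) = (\<Prod>b\<in>Basis. (u - l) \<bullet> b)" .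
qed simp

text \<open>The identification of the plane \<open>real ^ 2\<close> with \<open>complex\<close> maps boxes to boxes of the same
  area, so it carries the invariance under orthogonal maps over to \<open>complex\<close>.\<close>

lemma distr_lborel_Complex:
  "distr lborel borel (\<lambda>v :: real^2. Complex (v $ 1) (v $ 2)) = lborel"
proof (rule sym, rule lborel_eqI)
  fix l u :: complex
  assume lu: "\<And>b. b \<in> Basis \<Longrightarrow> l \<bullet> b \<le> u \<bullet> b"
  have B: "(Basis :: (real^2) set) = {axis 1 1, axis 2 1}"
    by (auto simp: Basis_vec_def UNIV_2)
  have ne: "axis 1 1 \<noteq> (axis 2 1 :: real^2)"
    by (simp add: axis_eq_axis)
  have [measurable]: "(\<lambda>v :: real^2. Complex (v $ 1) (v $ 2)) \<in> borel_measurable borel"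
    unfolding Complex_eq by (intro borel_measurable_continuous_onI continuous_intros)
  have "(\<lambda>v :: real^2. Complex (v $ 1) (v $ 2)) -` box l u =
      box (vector [Re l, Im l]) (vector [Re u, Im u])"
    by (auto simp: box_def B Basis_complex_def inner_axis vector_2)
  then show "emeasure (distr lborel borel (\<lambda>v :: real^2. Complex (v $ 1) (v $ 2))) (box l u)
      = (\<Prod>b\<in>Basis. (u - l) \<bullet> b)"
    using lu[of 1] lu[of \<i>] ne
    by (simp add: emeasure_distr emeasure_lborel_box_eq B Basis_complex_def inner_axis vector_2)
qed simp

text \<open>Multiplication by \<open>cis t\<close> is conjugate, under the identification \<open>h\<close>, to the rotation matrix
  \<open>T\<close> with angle \<open>t\<close>, and both \<open>h\<close> and \<open>T\<close> preserve Lebesgue measure.\<close>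

lemma distr_lborel_cis_mult:
  "distr lborel borel (\<lambda>z. cis t * z) = lborel"
proof -
  define h where "h = (\<lambda>v :: real^2. Complex (v $ 1) (v $ 2))"
  define T :: "real^2 \<Rightarrow> real^2" where
    "T = (\<lambda>v. vector [cos t * v $ 1 - sin t * v $ 2, sin t * v $ 1 + cos t * v $ 2])"
  have T: "orthogonal_transformation T"
    unfolding orthogonal_transformation_def
  proof (intro conjI allI)
    show "linear T"
      by (rule linearI) (simp_all add: T_def vec_eq_iff forall_2 vector_2 algebra_simps)
    have "T v \<bullet> T w = ((cos t)\<^sup>2 + (sin t)\<^sup>2) * (v \<bullet> w)" for v w
      unfolding T_def inner_vec_def sum_2 vector_2 inner_real_def by algebra
    then show "T v \<bullet> T w = v \<bullet> w" for v w
      by simp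
  qed
  have [measurable]: "T \<in> borel_measurable borel"
    using T by (intro borel_measurable_continuous_onI linear_continuous_on
        linear_linear[THEN iffD2] orthogonal_transformation_linear)
  have [measurable]: "h \<in> borel_measurable borel"
    unfolding h_def Complex_eq by (intro borel_measurable_continuous_onI continuous_intros)
  have comm: "(\<lambda>z. cis t * z) \<circ> h = h \<circ> T"
    by (auto simp: h_def T_def fun_eq_iff complex_eq_iff vector_2)
  have "distr lborel borel (\<lambda>z. cis t * z) = distr (distr lborel borel h) borel (\<lambda>z. cis t * z)"
    by (simp add: distr_lborel_Complex h_def)
  also have "\<dots> = distr (distr lborel borel T) borel h"
    by (simp add: distr_distr comm)
  also have "\<dots> = lborel"
    unfolding distr_lborel_orthogonal_transformation[OF T] by (simp add: h_def distr_lborel_Complex)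
  finally show ?thesis .
qed

lemma nn_integral_lborel_rigid_motion:
  fixes a :: complex
  assumes [measurable]: "F \<in> borel_measurable borel"
  shows "(\<integral>\<^sup>+ w. F (a + cis t * w) \<partial>lborel) = (\<integral>\<^sup>+ z. F z \<partial>lborel)"
proof -
  have "(\<integral>\<^sup>+ z. F z \<partial>lborel) = (\<integral>\<^sup>+ z. F z \<partial>distr lborel borel ((+) a))"
    by (simp add: lborel_distr_plus)
  also have "\<dots> = (\<integral>\<^sup>+ z. F (a + z) \<partial>distr lborel borel (\<lambda>z. cis t * z))"
    by (simp add: nn_integral_distr distr_lborel_cis_mult)
  also have "\<dots> = (\<integral>\<^sup>+ w. F (a + cis t * w) \<partial>lborel)"
    by (simp add: nn_integral_distr)
  finally show ?thesis by simp
qed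

section \<open>Mean values of entire functions\<close>

text \<open>Cauchy's formula at the centre of the unit circle for \<open>u \<mapsto> F (a + u * w)\<close>. The radius
  vector \<open>w\<close> is a parameter, and the path is always the unit circle, so that the formula covers
  \<open>w = 0\<close> and can be integrated over all \<open>w\<close> in a disc.\<close>

lemma entire_mean_value_circle:
  assumes F: "F holomorphic_on UNIV"
  shows "((\<lambda>t. F (a + cis (2 * pi * t) * w)) has_integral F a) {0..1}"
proof -
  define G where "G = (\<lambda>u. F (a + u * w))"
  have "G holomorphic_on UNIV"
    unfolding G_def by (intro holomorphic_on_compose_gen[OF _ F, unfolded o_def] holomorphic_intros) auto
  then have "((\<lambda>u. G u / (u - 0)) has_contour_integral 2 * of_real pi * \<i> * G 0) (circlepath 0 1)"
    by (intro Cauchy_integral_circlepath_simple) (auto intro: holomorphic_on_subset)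
  then have "((\<lambda>t. (2 * of_real pi * \<i>) * G (cis (2 * pi * t))) has_integral
      2 * of_real pi * \<i> * G 0) {0..1}"
    unfolding has_contour_integral
    by (rule has_integral_eq[rotated])
       (simp add: vector_derivative_circlepath, simp add: circlepath cis_conv_exp mult_ac)
  from has_integral_mult_right[OF this, of "1 / (2 * of_real pi * \<i>)"]
  show ?thesis
    by (simp add: G_def)
qed

lemma cmod_entire_le_nn_integral_circle:
  assumes F: "F holomorphic_on UNIV"
  shows "ennreal (cmod (F a)) \<le>
    (\<integral>\<^sup>+ t. ennreal (cmod (F (a + cis (2 * pi * t) * w))) * indicator {0..1} t \<partial>lborel)"
proof -
  let ?h = "\<lambda>t::real. F (a + cis (2 * pi * t) * w)"
  have cont: "continuous_on UNIV ?h"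
    by (intro continuous_on_compose2[OF holomorphic_on_imp_continuous_on[OF F]] continuous_intros) auto
  have int: "set_integrable lborel {0..1} ?h"
    using cont by (intro borel_integrable_atLeastAtMost') (auto intro: continuous_on_subset)
  then have "integral {0..1} ?h = (LINT t:{0..1}|lborel. ?h t)"
    by (rule set_borel_integral_eq_integral(2)[symmetric])
  then have "F a = (LINT t|lborel. indicator {0..1} t *\<^sub>R ?h t)"
    using integral_unique[OF entire_mean_value_circle[OF F, of a w]]
    by (simp add: set_lebesgue_integral_def)
  also have "ennreal (cmod \<dots>) \<le> (\<integral>\<^sup>+ t. ennreal (cmod (indicator {0..1} t *\<^sub>R ?h t)) \<partial>lborel)"
    using int unfolding set_integrable_def by (rule integral_norm_bound_ennreal)
  also have "\<dots> = (\<integral>\<^sup>+ t. ennreal (cmod (?h t)) * indicator {0..1} t \<partial>lborel)"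
    by (intro nn_integral_cong) (auto split: split_indicator)
  finally show ?thesis .
qed

text \<open>The mean value inequality holds for the circle about \<open>a\<close> through \<open>a + w\<close>, for every \<open>w\<close> in the
  unit disc. Integrating over \<open>w\<close> and exchanging the integrals leaves, for each angle, the integral
  over a rotated copy of the disc about \<open>a\<close>, which does not depend on the angle.\<close>

lemma entire_sub_mean_value_disc:
  assumes F: "F holomorphic_on UNIV"
  shows "ennreal (cmod (F a)) * emeasure lborel (ball (0::complex) 1) \<le>
    (\<integral>\<^sup>+ z. ennreal (cmod (F z)) * indicator (ball a 1) z \<partial>lborel)"
proof -
  have [measurable]: "F \<in> borel_measurable borel"
    using F by (intro borel_measurable_continuous_onI holomorphic_on_imp_continuous_on)
  have [measurable]: "cis \<in> borel_measurable borel"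
    by (intro borel_measurable_continuous_onI continuous_intros)
  define G where "G = (\<lambda>z. ennreal (cmod (F z)) * indicator (ball a 1) z)"
  have [measurable]: "G \<in> borel_measurable borel"
    unfolding G_def by (intro borel_measurable_times_ennreal borel_measurable_indicator) measurable
  have ball: "indicator (ball a 1) (a + cis s * w) = (indicator (ball 0 1) w :: ennreal)" for s w
    by (simp add: indicator_def dist_norm norm_mult)
  have "ennreal (cmod (F a)) * emeasure lborel (ball (0::complex) 1) =
      (\<integral>\<^sup>+ w. ennreal (cmod (F a)) * indicator (ball (0::complex) 1) w \<partial>lborel)"
    by (simp add: nn_integral_cmult_indicator)
  also have "\<dots> \<le> (\<integral>\<^sup>+ w. (\<integral>\<^sup>+ t. ennreal (cmod (F (a + cis (2 * pi * t) * w)))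
      * indicator {0..1} t \<partial>lborel) * indicator (ball 0 1) w \<partial>lborel)"
    by (intro nn_integral_mono mult_right_mono cmod_entire_le_nn_integral_circle F) auto
  also have "\<dots> = (\<integral>\<^sup>+ w. (\<integral>\<^sup>+ t. G (a + cis (2 * pi * t) * w) * indicator {0..1} t \<partial>lborel) \<partial>lborel)"
  proof (rule nn_integral_cong)
    fix w :: complex
    have "(\<lambda>t. ennreal (cmod (F (a + cis (2 * pi * t) * w))) * indicator {0..1} t)
        \<in> borel_measurable lborel"
      by measurable
    from nn_integral_multc[OF this, of "indicator (ball 0 1) w", symmetric]
    show "(\<integral>\<^sup>+ t. ennreal (cmod (F (a + cis (2 * pi * t) * w))) * indicator {0..1} t \<partial>lborel)
        * indicator (ball 0 1) w
        = (\<integral>\<^sup>+ t. G (a + cis (2 * pi * t) * w) * indicator {0..1} t \<partial>lborel)"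
      unfolding G_def ball by (simp only: mult_ac)
  qed
  also have "\<dots> = (\<integral>\<^sup>+ t. (\<integral>\<^sup>+ w. G (a + cis (2 * pi * t) * w) * indicator {0..1} t \<partial>lborel) \<partial>lborel)"
    by (rule lborel_pair.Fubini') measurable
  also have "\<dots> = (\<integral>\<^sup>+ t. (\<integral>\<^sup>+ z. G z \<partial>lborel) * indicator {0..1::real} t \<partial>lborel)"
  proof (rule nn_integral_cong)
    fix t :: real
    have "(\<lambda>w. G (a + cis (2 * pi * t) * w)) \<in> borel_measurable lborel"
      by measurable
    from nn_integral_multc[OF this]
    show "(\<integral>\<^sup>+ w. G (a + cis (2 * pi * t) * w) * indicator {0..1} t \<partial>lborel)
        = (\<integral>\<^sup>+ z. G z \<partial>lborel) * indicator {0..1} t"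
      by (simp only: nn_integral_lborel_rigid_motion[OF \<open>G \<in> borel_measurable borel\<close>])
  qed
  also have "\<dots> = (\<integral>\<^sup>+ z. G z \<partial>lborel)"
    by (simp add: nn_integral_cmult)
  finally show ?thesis unfolding G_def .
qed

section \<open>Point evaluations on Fock space\<close>

lemma fock_norm_nn_integral:
  assumes "f \<in> fock_space"
  shows "(\<integral>\<^sup>+ z. ennreal ((cmod (f z))\<^sup>2 * exp (- (cmod z)\<^sup>2)) \<partial>lborel) = ennreal (pi * (fock_norm f)\<^sup>2)"
  using fock_space_integrable[OF assms]
  by (simp add: fock_norm_power2 nn_integral_eq_integral)

text \<open>The mean value inequality is applied to \<open>f\<^sup>2\<close>, which turns a bound by an \<open>L\<^sup>1\<close>-norm into one by an
  \<open>L\<^sup>2\<close>-norm. The unit disc about \<open>a\<close> lies in the disc of radius \<open>R + 1\<close> about the origin, where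
  the weight is at least \<open>exp (- (R + 1)\<^sup>2)\<close>. The area \<open>\<pi>\<close> of the disc cancels the normalization of
  the inner product.\<close>

lemma fock_eval_bound:
  assumes f: "f \<in> fock_space" and a: "cmod a \<le> R"
  shows "cmod (f a) \<le> exp ((R + 1)\<^sup>2 / 2) * fock_norm f"
proof -
  have hol: "(\<lambda>z. (f z)\<^sup>2) holomorphic_on UNIV"
    by (intro holomorphic_intros fock_space_holomorphic f)
  have R: "R \<ge> 0"
    using a norm_ge_zero order_trans by blast
  have vol: "emeasure lborel (ball (0::complex) 1) = ennreal pi"
    by (simp add: emeasure_ball unit_ball_vol_2)
  have "ennreal ((cmod (f a))\<^sup>2 * pi) = ennreal (cmod ((f a)\<^sup>2)) * ennreal pi"
    by (simp add: norm_power ennreal_mult)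
  also have "\<dots> \<le> (\<integral>\<^sup>+ z. ennreal (cmod ((f z)\<^sup>2)) * indicator (ball a 1) z \<partial>lborel)"
    using entire_sub_mean_value_disc[OF hol, of a] by (simp add: vol)
  also have "\<dots> \<le> (\<integral>\<^sup>+ z. ennreal (exp ((R + 1)\<^sup>2)) *
      ennreal ((cmod (f z))\<^sup>2 * exp (- (cmod z)\<^sup>2)) \<partial>lborel)"
  proof (rule nn_integral_mono)
    fix z
    show "ennreal (cmod ((f z)\<^sup>2)) * indicator (ball a 1) z \<le>
        ennreal (exp ((R + 1)\<^sup>2)) * ennreal ((cmod (f z))\<^sup>2 * exp (- (cmod z)\<^sup>2))"
    proof (cases "z \<in> ball a 1")
      case True
      then have "cmod z \<le> R + 1"
        using a norm_triangle_ineq2[of z a] by (simp add: dist_norm norm_minus_commute)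
      then have "(cmod z)\<^sup>2 \<le> (R + 1)\<^sup>2"
        by (intro power_mono) auto
      then have "1 \<le> exp ((R + 1)\<^sup>2) * exp (- (cmod z)\<^sup>2)"
        by (simp flip: exp_add)
      then have "(cmod (f z))\<^sup>2 * 1 \<le> (cmod (f z))\<^sup>2 * (exp ((R + 1)\<^sup>2) * exp (- (cmod z)\<^sup>2))"
        by (intro mult_left_mono) auto
      with True show ?thesis
        by (simp add: norm_power ennreal_mult[symmetric] mult_ac ennreal_leI)
    qed simp
  qed
  also have "\<dots> = ennreal (exp ((R + 1)\<^sup>2)) * ennreal (pi * (fock_norm f)\<^sup>2)"
    using borel_measurable_integrable[OF fock_space_integrable[OF f]]
    by (simp add: nn_integral_cmult fock_norm_nn_integral[OF f])
  also have "\<dots> = ennreal (exp ((R + 1)\<^sup>2) * (pi * (fock_norm f)\<^sup>2))"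
    by (simp add: ennreal_mult)
  finally have "(cmod (f a))\<^sup>2 * pi \<le> exp ((R + 1)\<^sup>2) * (pi * (fock_norm f)\<^sup>2)"
    by (simp add: ennreal_le_iff)
  then have "(cmod (f a))\<^sup>2 \<le> exp ((R + 1)\<^sup>2) * (fock_norm f)\<^sup>2"
    by (simp add: mult_ac)
  also have "\<dots> = (exp ((R + 1)\<^sup>2 / 2) * fock_norm f)\<^sup>2"
    by (simp add: power_mult_distrib flip: exp_double)
  finally show ?thesis
    by (rule power2_le_imp_le) simp
qed

text \<open>Cauchy's inequality on the unit circle about \<open>z\<close>, all of whose points have modulus at most
  \<open>cmod z + 1\<close>.\<close>

lemma fock_higher_deriv_bound:
  assumes f: "f \<in> fock_space"
  shows "cmod ((deriv ^^ n) f z) \<le> fact n * exp ((cmod z + 2)\<^sup>2 / 2) * fock_norm f"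
proof -
  have hol: "f holomorphic_on S" for S
    using fock_space_holomorphic[OF f] by (rule holomorphic_on_subset) simp
  have "cmod (f x) \<le> exp ((cmod z + 2)\<^sup>2 / 2) * fock_norm f" if "cmod (z - x) = 1" for x
  proof -
    have "cmod x \<le> cmod z + 1"
      using norm_triangle_ineq2[of x z] that by (simp add: norm_minus_commute)
    from fock_eval_bound[OF f this] show ?thesis by (simp add: add_ac)
  qed
  then have "cmod ((deriv ^^ n) f z) \<le> fact n * (exp ((cmod z + 2)\<^sup>2 / 2) * fock_norm f) / 1 ^ n"
    by (intro Cauchy_inequality hol holomorphic_on_imp_continuous_on) auto
  then show ?thesis by (simp add: mult_ac)
qed

lemma continuous_map_fock_higher_deriv:
  "continuous_map fock_topology euclidean (\<lambda>f. (deriv ^^ n) f z)"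
proof -
  interpret Metric_space fock_space fock_dist by (rule Metric_space_fock)
  define C where "C = fact n * exp ((cmod z + 2)\<^sup>2 / 2)"
  have C: "C > 0" by (simp add: C_def)
  have lip: "dist ((deriv ^^ n) f z) ((deriv ^^ n) g z) \<le> C * fock_dist f g"
    if "f \<in> fock_space" "g \<in> fock_space" for f g
    using fock_higher_deriv_bound[OF fock_space_diff[OF that], of n z] that
    by (simp add: higher_deriv_diff[of _ UNIV] fock_space_holomorphic dist_norm fock_dist_def C_def)
  show ?thesis
    unfolding fock_topology_def continuous_map_from_metric
  proof (intro conjI ballI allI impI)
    fix f U
    assume f: "f \<in> fock_space" and "openin euclidean U \<and> (deriv ^^ n) f z \<in> U"
    then obtain e where e: "e > 0" "\<And>y. dist ((deriv ^^ n) f z) y < e \<Longrightarrow> y \<in> U"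
      by (auto simp: open_dist dist_commute)
    have "(deriv ^^ n) g z \<in> U" if g: "g \<in> fock_space" "fock_dist f g < e / C" for g
    proof -
      have "C * fock_dist f g < e"
        using g(2) C by (simp add: field_simps)
      with lip[OF f g(1)] show ?thesis
        by (intro e(2)) simp
    qed
    then show "\<exists>r>0. \<forall>g. g \<in> fock_space \<and> fock_dist f g < r \<longrightarrow> (deriv ^^ n) g z \<in> U"
      using e(1) C by (intro exI[of _ "e / C"]) auto
  qed auto
qed

section \<open>Closedness of the maximal operator\<close>

theorem proposition3p2:
  fixes m :: nat and \<psi> \<phi> \<Phi> :: "complex \<Rightarrow> complex"
  assumes "\<psi> holomorphic_on UNIV" and "\<phi> holomorphic_on UNIV" and "\<Phi> holomorphic_on UNIV"
  shows "closedin (prod_topology fock_topology fock_topology) (Smax_graph m \<psi> \<phi> \<Phi>)"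
proof -
  let ?X = "prod_topology fock_topology fock_topology"
  interpret Metric_space fock_space fock_dist by (rule Metric_space_fock)
  have top: "topspace fock_topology = fock_space"
    by (simp add: fock_topology_def)
  \<comment> \<open>The graph is the common zero set of the continuous functionals \<open>D z\<close>.\<close>
  define D where "D = (\<lambda>z (f, g). \<psi> z * f (\<phi> z) - \<Phi> z * (deriv ^^ m) g z)"
  have "continuous_map ?X euclidean (D z)" for z
  proof -
    \<comment> \<open>Evaluation of \<open>f\<close> is the case of the derivative of order 0.\<close>
    have "continuous_map ?X euclidean ((\<lambda>f. f (\<phi> z)) \<circ> fst)"
      using continuous_map_compose[OF continuous_map_fst continuous_map_fock_higher_deriv[of 0 "\<phi> z"]]
      by simp
    moreover have "continuous_map ?X euclidean ((\<lambda>g. (deriv ^^ m) g z) \<circ> snd)"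
      by (rule continuous_map_compose[OF continuous_map_snd continuous_map_fock_higher_deriv])
    moreover have "continuous_map euclidean euclidean ((*) c)" for c :: complex
      by (simp add: continuous_intros)
    ultimately have "continuous_map ?X euclidean ((*) (\<psi> z) \<circ> ((\<lambda>f. f (\<phi> z)) \<circ> fst))"
      and "continuous_map ?X euclidean ((*) (\<Phi> z) \<circ> ((\<lambda>g. (deriv ^^ m) g z) \<circ> snd))"
      by (blast intro: continuous_map_compose)+
    from continuous_map_diff[OF this] show ?thesis
      by (simp add: D_def case_prod_unfold)
  qed
  then have "closedin ?X {p \<in> topspace ?X. D z p \<in> {0}}" for z
    by (rule closedin_continuous_map_preimage) simp
  then have "closedin ?X (\<Inter>z. {p \<in> topspace ?X. D z p \<in> {0}})"
    by (intro closedin_Inter) auto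
  also have "(\<Inter>z. {p \<in> topspace ?X. D z p \<in> {0}}) = Smax_graph m \<psi> \<phi> \<Phi>"
    by (auto simp: top D_def Smax_graph_def)
  finally show ?thesis .
qed

end
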